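(* Allowing graphs to have loops, there exists a nontrivially unstable graph pair $(\Gamma,\Sigma)$, where $\Gamma$ is non-bipartite and $\Sigma$ is bipartite, such that there exists a $\Sigma$-mixer of $\Gamma\times\Sigma$ and each connected component of the Cartesian skeleton $S(\Sigma)$ is Cartesian-quasicoprime to the Cartesian skeleton $S(\Gamma)$.
   Context: Graphs are finite and undirected, without multiple edges; loops are allowed (a loop at $u$ means $u\in N(u)$). The direct product $\Gamma\times\Sigma$ has vertex set $V(\Gamma)\times V(\Sigma)$, with $(u,v)$ adjacent to $(x,y)$ if and only if $u$ is adjacent to $x$ in $\Gamma$ and $v$ is adjacent to $y$ in $\Sigma$. The pair $(\Gamma,\Sigma)$ is stable if $\mathrm{Aut}(\Gamma\times\Sigma)=\mathrm{Aut}(\Gamma)\times\mathrm{Aut}(\Sigma)$ (acting componentwise), and unstable otherwise. A graph is twin-free if no two distinct vertices have the same neighbourhood. Graphs $\Gamma,\Sigma$ are coprime if there is no graph $\Delta$ of order greater than $1$ such that $\Gamma\cong\Gamma'\times\Delta$ and $\Sigma\cong\Sigma'\times\Delta$ for some graphs $\Gamma',\Sigma'$. A graph pair is nontrivial if its members are coprime connected twin-free graphs and exactly one of them is bipartite; it is nontrivially unstable if it is nontrivial and unstable. A bipartite graph here has two nonempty partite sets. The $\Sigma$-partition of $V(\Gamma\times\Sigma)$ is $\{V(\Gamma)\times\{x\}: x\in V(\Sigma)\}$. An automorphism of $\Gamma\times\Sigma$ is a $\Sigma$-mixer if it does not preserve the $\Sigma$-partition. The Boolean square $B(\Gamma)$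 has vertex set $V(\Gamma)$ and edges $\{u,v\}$ with $u\ne v$ and $N(u)\cap N(v)\neq\varnothing$. An edge $\{u,v\}$ of $B(\Gamma)$ is dispensable if there is $w\in V(\Gamma)$ such that both: (i) $N(u)\cap N(v)\subsetneq N(u)\cap N(w)$ or $N(u)\subsetneq N(w)\subsetneq N(v)$; and (ii) $N(v)\cap N(u)\subsetneq N(v)\cap N(w)$ or $N(v)\subsetneq N(w)\subsetneq N(u)$. The Cartesian skeleton $S(\Gamma)$ is obtained from $B(\Gamma)$ by removing all dispensable edges. The Cartesian product $\Gamma\Box\Sigma$ has vertex set $V(\Gamma)\times V(\Sigma)$, with $(u,i)$ adjacent to $(v,j)$ if and only if either $u=v$ and $i$ is adjacent to $j$, or $i=j$ and $u$ is adjacent to $v$. A loopless graph with more than one vertex is Cartesian-prime if it is not a Cartesian product of two graphs each with more than one vertex; every connected graph has a unique factorization into Cartesian-primes up to order and isomorphism. Two connected graphs are Cartesian-quasicoprime if for every common Cartesian-prime factor $\Delta$ of the two graphs, the Cartesian-prime factorization of neither of them contains at least two factors isomorphic to $\Delta$. *)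

theory Defs
  imports "Graph_Theory.Graph_Theory" "HOL-Library.FuncSet"
begin

text \<open>
  A graph is a \<^locale>\<open>pair_pseudo_graph\<close>: a finite vertex set together with a symmetric set of
  arcs, loops allowed and no multiple edges. Auxiliary graphs that are quantified over
  have type \<^typ>\<open>nat pair_pre_digraph\<close>; this is no restriction, as graphs are finite and
  are only considered up to isomorphism there.
\<close>

abbreviation pair_iso :: "'a pair_pre_digraph \<Rightarrow> 'b pair_pre_digraph \<Rightarrow> bool"
    (infix "\<simeq>\<^sub>g" 50) where
  "G \<simeq>\<^sub>g H \<equiv> digraph_iso (with_proj G) (with_proj H)"

abbreviation nbhd :: "'a pair_pre_digraph \<Rightarrow> 'a \<Rightarrow> 'a set" where
  "nbhd G u \<equiv> parcs G `` {u}"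

definition twin_free :: "'a pair_pre_digraph \<Rightarrow> bool" where
  "twin_free G \<longleftrightarrow> (\<forall>u\<in>pverts G. \<forall>v\<in>pverts G. u \<noteq> v \<longrightarrow> nbhd G u \<noteq> nbhd G v)"

definition bipartite :: "'a pair_pre_digraph \<Rightarrow> bool" where
  "bipartite G \<longleftrightarrow>
    (\<exists>A B. A \<noteq> {} \<and> B \<noteq> {} \<and> A \<inter> B = {} \<and> A \<union> B = pverts G \<and>
      parcs G \<subseteq> A \<times> B \<union> B \<times> A)"


subsection \<open>Direct products and stability\<close>

definition direct_product ::
    "'a pair_pre_digraph \<Rightarrow> 'b pair_pre_digraph \<Rightarrow> ('a \<times> 'b) pair_pre_digraph"
    (infixr "\<otimes>\<^sub>g" 70) where
  "G \<otimes>\<^sub>g H = \<lparr> pverts = pverts G \<times> pverts H,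
     parcs = {((u, v), (x, y)) | u v x y. (u, x) \<in> parcs G \<and> (v, y) \<in> parcs H} \<rparr>"

text \<open>
  Automorphisms are permutations of the vertex set; being extensional makes them determined
  by their values there, so that sets of automorphisms can be compared.
\<close>

definition automorphisms :: "'a pair_pre_digraph \<Rightarrow> ('a \<Rightarrow> 'a) set" where
  "automorphisms G = {f \<in> extensional (pverts G). bij_betw f (pverts G) (pverts G) \<and>
     (\<forall>u\<in>pverts G. \<forall>v\<in>pverts G. (f u, f v) \<in> parcs G \<longleftrightarrow> (u, v) \<in> parcs G)}"

definition stable :: "'a pair_pre_digraph \<Rightarrow> 'b pair_pre_digraph \<Rightarrow> bool" where
  "stable G H \<longleftrightarrow> automorphisms (G \<otimes>\<^sub>g H) =
     {restrict (map_prod f g) (pverts G \<times> pverts H) | f g.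
        f \<in> automorphisms G \<and> g \<in> automorphisms H}"

definition coprime_graphs :: "'a pair_pre_digraph \<Rightarrow> 'b pair_pre_digraph \<Rightarrow> bool" where
  "coprime_graphs G H \<longleftrightarrow>
     \<not> (\<exists>(D :: nat pair_pre_digraph) (G' :: nat pair_pre_digraph) (H' :: nat pair_pre_digraph).
          pair_pseudo_graph D \<and> pair_pseudo_graph G' \<and> pair_pseudo_graph H' \<and>
          card (pverts D) > 1 \<and> G \<simeq>\<^sub>g G' \<otimes>\<^sub>g D \<and> H \<simeq>\<^sub>g H' \<otimes>\<^sub>g D)"

definition nontrivial_pair :: "'a pair_pre_digraph \<Rightarrow> 'b pair_pre_digraph \<Rightarrow> bool" where
  "nontrivial_pair G H \<longleftrightarrow> coprime_graphs G H \<and>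
     connected (with_proj G) \<and> connected (with_proj H) \<and> twin_free G \<and> twin_free H \<and>
     (bipartite G \<longleftrightarrow> \<not> bipartite H)"

definition nontrivially_unstable :: "'a pair_pre_digraph \<Rightarrow> 'b pair_pre_digraph \<Rightarrow> bool" where
  "nontrivially_unstable G H \<longleftrightarrow> nontrivial_pair G H \<and> \<not> stable G H"

definition snd_partition ::
    "'a pair_pre_digraph \<Rightarrow> 'b pair_pre_digraph \<Rightarrow> ('a \<times> 'b) set set" where
  "snd_partition G H = {pverts G \<times> {x} | x. x \<in> pverts H}"

definition mixer ::
    "'a pair_pre_digraph \<Rightarrow> 'b pair_pre_digraph \<Rightarrow> ('a \<times> 'b \<Rightarrow> 'a \<times> 'b) \<Rightarrow> bool" where
  "mixer G H \<phi> \<longleftrightarrow> \<phi> \<in> automorphisms (G \<otimes>\<^sub>g H) \<and>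
     (\<lambda>P. \<phi> ` P) ` snd_partition G H \<noteq> snd_partition G H"


subsection \<open>The Cartesian skeleton\<close>

definition boolean_square :: "'a pair_pre_digraph \<Rightarrow> 'a pair_pre_digraph" where
  "boolean_square G = \<lparr> pverts = pverts G,
     parcs = {(u, v). u \<in> pverts G \<and> v \<in> pverts G \<and> u \<noteq> v \<and> nbhd G u \<inter> nbhd G v \<noteq> {}} \<rparr>"

definition dispensable :: "'a pair_pre_digraph \<Rightarrow> 'a \<Rightarrow> 'a \<Rightarrow> bool" where
  "dispensable G u v \<longleftrightarrow> (\<exists>w\<in>pverts G.
     (nbhd G u \<inter> nbhd G v \<subset> nbhd G u \<inter> nbhd G w \<or>
      nbhd G u \<subset> nbhd G w \<and> nbhd G w \<subset> nbhd G v) \<and>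
     (nbhd G v \<inter> nbhd G u \<subset> nbhd G v \<inter> nbhd G w \<or>
      nbhd G v \<subset> nbhd G w \<and> nbhd G w \<subset> nbhd G u))"

definition cartesian_skeleton :: "'a pair_pre_digraph \<Rightarrow> 'a pair_pre_digraph" where
  "cartesian_skeleton G = \<lparr> pverts = pverts G,
     parcs = {(u, v) \<in> parcs (boolean_square G). \<not> dispensable G u v} \<rparr>"

text \<open>
  For symmetric digraphs strongly connected components are connected components. The lemma
  below shows that those of a pair digraph are again pair digraphs, so that quantifying over
  pair digraphs misses none of them.
\<close>

definition is_component :: "'a pair_pre_digraph \<Rightarrow> 'a pair_pre_digraph \<Rightarrow> bool" where
  "is_component C G \<longleftrightarrow> with_proj C \<in> pre_digraph.sccs (with_proj G)"

lemma sccs_with_projE: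
  assumes "H \<in> pre_digraph.sccs (with_proj G)"
  obtains C where "H = with_proj C" "is_component C G"
proof -
  have "compatible (with_proj G) H"
    using assms by (auto simp: pre_digraph.sccs_def induced_subgraph_def subgraph_def compatible_def)
  then have "H = with_proj \<lparr> pverts = verts H, parcs = arcs H \<rparr>"
    by (cases H) (simp add: compatible_def with_proj_def)
  then show thesis
    using assms that by (metis is_component_def)
qed


subsection \<open>Cartesian products and Cartesian-prime factorizations\<close>

definition cart_product ::
    "'a pair_pre_digraph \<Rightarrow> 'b pair_pre_digraph \<Rightarrow> ('a \<times> 'b) pair_pre_digraph"
    (infixr "\<box>\<^sub>g" 70) where
  "G \<box>\<^sub>g H = \<lparr> pverts = pverts G \<times> pverts H,
     parcs = {((u, i), (v, j)) | u i v j.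
       u \<in> pverts G \<and> v \<in> pverts G \<and> i \<in> pverts H \<and> j \<in> pverts H \<and>
       (u = v \<and> (i, j) \<in> parcs H \<or> i = j \<and> (u, v) \<in> parcs G)} \<rparr>"

definition cart_prime :: "'a pair_pre_digraph \<Rightarrow> bool" where
  "cart_prime G \<longleftrightarrow> pair_graph G \<and> card (pverts G) > 1 \<and>
     \<not> (\<exists>(A :: nat pair_pre_digraph) (B :: nat pair_pre_digraph).
          pair_pseudo_graph A \<and> pair_pseudo_graph B \<and>
          card (pverts A) > 1 \<and> card (pverts B) > 1 \<and> G \<simeq>\<^sub>g A \<box>\<^sub>g B)"

text \<open>
  The Cartesian product of a list of graphs, with lists as vertices; the empty product is the
  one-vertex graph without a loop.
\<close>

primrec cart_product_list :: "'a pair_pre_digraph list \<Rightarrow> 'a list pair_pre_digraph" where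
  "cart_product_list [] = \<lparr> pverts = {[]}, parcs = {} \<rparr>"
| "cart_product_list (F # Fs) =
     (let P = F \<box>\<^sub>g cart_product_list Fs; c = (\<lambda>(x, xs). x # xs)
      in \<lparr> pverts = c ` pverts P, parcs = map_prod c c ` parcs P \<rparr>)"

definition cart_prime_factorization ::
    "'a pair_pre_digraph \<Rightarrow> nat pair_pre_digraph list \<Rightarrow> bool" where
  "cart_prime_factorization G Fs \<longleftrightarrow>
     (\<forall>F\<in>set Fs. cart_prime F) \<and> G \<simeq>\<^sub>g cart_product_list Fs"

text \<open>
  Connected loopless graphs have a Cartesian-prime factorization, unique up to order and
  isomorphism, so it is immaterial that the definition ranges over all factorizations.
\<close>

definition cart_quasicoprime :: "'a pair_pre_digraph \<Rightarrow> 'b pair_pre_digraph \<Rightarrow> bool" where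
  "cart_quasicoprime G H \<longleftrightarrow>
     pair_graph G \<and> connected (with_proj G) \<and> pair_graph H \<and> connected (with_proj H) \<and>
     (\<forall>Gs Hs (D :: nat pair_pre_digraph).
        cart_prime_factorization G Gs \<and> cart_prime_factorization H Hs \<and> cart_prime D \<and>
        (\<exists>F\<in>set Gs. F \<simeq>\<^sub>g D) \<and> (\<exists>F\<in>set Hs. F \<simeq>\<^sub>g D) \<longrightarrow>
        length (filter (\<lambda>F. F \<simeq>\<^sub>g D) Gs) < 2 \<and> length (filter (\<lambda>F. F \<simeq>\<^sub>g D) Hs) < 2)"

end

theory Submission
  imports Defs "HOL-Computational_Algebra.Squarefree"
begin

text \<open>
  Let \<open>X\<close> be the biadjacency relation of a bipartite graph \<open>\<Sigma>\<close>, between rows and columns, and let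
  \<open>\<Gamma>\<close> have as vertices the pairs of a row and a column, where \<open>(a, b)\<close> is adjacent to \<open>(a', b')\<close>
  if and only if \<open>X a b'\<close> and \<open>X a' b\<close>. An arc of \<open>\<Gamma> \<times> \<Sigma>\<close> from \<open>((a, b), a0)\<close> to
  \<open>((a', b'), b0)\<close> then says \<open>X a b'\<close>, \<open>X a' b\<close> and \<open>X a0 b0\<close>, so that exchanging \<open>a\<close> with \<open>a0\<close>
  on one side and \<open>b'\<close> with \<open>b0\<close> on the other is an automorphism, and it mixes. For \<open>\<Sigma>\<close> the path
  with five vertices, \<open>\<Gamma>\<close> has six vertices, whence coprimality. The components of \<open>S(\<Sigma>)\<close> have
  2 and 3 vertices and \<open>S(\<Gamma>)\<close> has 6; as these numbers are squarefree, no Cartesian-prime factor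
  can be repeated.
\<close>

section \<open>Orders of graphs and factors\<close>

lemma pair_iso_card_eq:
  assumes "G \<simeq>\<^sub>g H"
  shows "card (pverts G) = card (pverts H)"
proof -
  obtain f where f: "pre_digraph.digraph_isomorphism (with_proj G) f"
    and H: "with_proj H = app_iso f (with_proj G)"
    using assms unfolding digraph_iso_def by blast
  have "inj_on (iso_verts f) (pverts G)"
    using f unfolding pre_digraph.digraph_isomorphism_def by simp
  moreover have "pverts H = iso_verts f ` pverts G"
    using arg_cong[OF H, of verts] by simp
  ultimately show ?thesis by (simp add: card_image)
qed

lemma card_direct_product:
  "card (pverts (G \<otimes>\<^sub>g H)) = card (pverts G) * card (pverts H)"
  by (simp add: direct_product_def card_cartesian_product)

text \<open>The order of a common direct factor divides both orders, since orders multiply.\<close>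

lemma coprime_graphs_if_coprime_card:
  assumes "coprime (card (pverts G)) (card (pverts H))"
  shows "coprime_graphs G H"
  unfolding coprime_graphs_def
proof (intro notI, elim exE conjE)
  fix D G' H' :: "nat pair_pre_digraph"
  assume "card (pverts D) > 1" "G \<simeq>\<^sub>g G' \<otimes>\<^sub>g D" "H \<simeq>\<^sub>g H' \<otimes>\<^sub>g D"
  then have "card (pverts D) dvd card (pverts G)" "card (pverts D) dvd card (pverts H)"
    by (auto dest!: pair_iso_card_eq simp: card_direct_product)
  with assms have "card (pverts D) = 1"
    using coprime_common_divisor_nat by blast
  with \<open>card (pverts D) > 1\<close> show False by simp
qed

lemma card_cart_product_list:
  "card (pverts (cart_product_list Fs)) = (\<Prod>F\<leftarrow>Fs. card (pverts F))"
proof (induction Fs)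
  case (Cons F Fs)
  have "card ((\<lambda>(x, xs). x # xs) ` pverts (F \<box>\<^sub>g cart_product_list Fs)) =
      card (pverts (F \<box>\<^sub>g cart_product_list Fs))"
    by (rule card_image) (auto simp: inj_on_def)
  with Cons show ?case
    by (simp add: Let_def cart_product_def card_cartesian_product)
qed simp

text \<open>Each listed factor isomorphic to \<open>D\<close> contributes one factor
  \<open>card (pverts D)\<close> to the product.\<close>

lemma pow_length_filter_iso_dvd:
  "card (pverts D) ^ length (filter (\<lambda>F. F \<simeq>\<^sub>g D) Fs) dvd (\<Prod>F\<leftarrow>Fs. card (pverts F))"
  by (induction Fs) (auto dest: pair_iso_card_eq intro: mult_dvd_mono)

text \<open>Two copies of \<open>D\<close> would make the square of its order divide a squarefree
  number, forcing order 1, while a prime has order above 1.\<close>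

lemma squarefree_card_imp_no_repeated_factor:
  assumes "squarefree (card (pverts G))" "cart_prime_factorization G Fs" "cart_prime D"
  shows "length (filter (\<lambda>F. F \<simeq>\<^sub>g D) Fs) < 2"
proof (rule ccontr)
  assume "\<not> ?thesis"
  then have "card (pverts D) ^ 2 dvd card (pverts D) ^ length (filter (\<lambda>F. F \<simeq>\<^sub>g D) Fs)"
    by (simp add: le_imp_power_dvd)
  also have "\<dots> dvd card (pverts G)"
    using assms(2) pow_length_filter_iso_dvd[of D Fs]
    by (auto simp: cart_prime_factorization_def card_cart_product_list dest!: pair_iso_card_eq)
  finally have "card (pverts D) dvd 1"
    using assms(1) unfolding squarefree_def by blast
  with assms(3) show False by (simp add: cart_prime_def)
qed

lemma cart_quasicoprime_if_squarefree_card: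
  assumes "pair_graph G" "connected (with_proj G)" "squarefree (card (pverts G))"
    and "pair_graph H" "connected (with_proj H)" "squarefree (card (pverts H))"
  shows "cart_quasicoprime G H"
  unfolding cart_quasicoprime_def
  by (intro conjI allI impI assms)
    (elim conjE, (rule squarefree_card_imp_no_repeated_factor[OF assms(3)]
      squarefree_card_imp_no_repeated_factor[OF assms(6)]; assumption))+


section \<open>Connectedness and skeletons\<close>

text \<open>Arcs are symmetric, so any two vertices are joined through the root \<open>r\<close>;
  this is carried to \<open>mk_symmetric\<close>, in terms of which \<open>connected\<close> is
  defined.\<close>

lemma connected_if_reachable_from:
  assumes G: "pair_pseudo_graph G" and r: "r \<in> pverts G"
    and reach: "\<And>v. v \<in> pverts G \<Longrightarrow> (r, v) \<in> (parcs G)\<^sup>*"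
  shows "connected (with_proj G)"
proof -
  interpret pair_pseudo_graph G by (fact G)
  have from_r: "r \<rightarrow>\<^sup>*\<^bsub>with_proj G\<^esub> v" if "v \<in> pverts G" for v
    using reach[OF that]
  proof (induction rule: rtrancl_induct)
    case base
    then show ?case using r by simp
  next
    case (step y z)
    then show ?case using reachable_adj_trans by blast
  qed
  have "strongly_connected (mk_symmetric (with_proj G))"
  proof (rule strongly_connectedI)
    fix u v
    assume "u \<in> verts (with_proj (mk_symmetric (with_proj G)))"
      "v \<in> verts (with_proj (mk_symmetric (with_proj G)))"
    then have "r \<rightarrow>\<^sup>*\<^bsub>with_proj G\<^esub> u" "r \<rightarrow>\<^sup>*\<^bsub>with_proj G\<^esub> v"
      using from_r by auto
    then have "u \<rightarrow>\<^sup>*\<^bsub>with_proj G\<^esub> v"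
      using symmetric_reachable[OF sym_arcs] reachable_trans by blast
    then show "u \<rightarrow>\<^sup>*\<^bsub>with_proj (mk_symmetric (with_proj G))\<^esub> v"
      by (rule reachable_mk_symmetricI)
  qed (use r in auto)
  then show ?thesis unfolding connected_def .
qed

text \<open>The two halves of dispensability are exchanged along with \<open>u\<close> and
  \<open>v\<close>, which gives symmetry; loops are already excluded in the Boolean square.\<close>

lemma pair_graph_cartesian_skeleton:
  assumes "finite (pverts G)"
  shows "pair_graph (cartesian_skeleton G)"
proof unfold_locales
  have "parcs (cartesian_skeleton G) \<subseteq> pverts G \<times> pverts G"
    by (auto simp: cartesian_skeleton_def boolean_square_def)
  then show "finite (parcs (cartesian_skeleton G))"
    using assms finite_subset by blast
  have "dispensable G u v \<longleftrightarrow> dispensable G v u" for u v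
    unfolding dispensable_def by blast
  then show "symmetric (with_proj (cartesian_skeleton G))"
    by (auto simp: symmetric_def cartesian_skeleton_def boolean_square_def sym_def)
qed (use assms in \<open>auto simp: cartesian_skeleton_def boolean_square_def\<close>)

text \<open>Components are induced subgraphs, so they inherit symmetry and looplessness.\<close>

lemma component_pair_graph_connected:
  assumes "pair_graph G" "is_component C G"
  shows "pair_graph C" and "connected (with_proj C)"
proof -
  interpret pair_graph G by (fact assms(1))
  have sub: "pverts C \<subseteq> pverts G" and arcs: "parcs C = {e \<in> parcs G. fst e \<in> pverts C \<and> snd e \<in> pverts C}"
    and sc: "strongly_connected (with_proj C)"
    using assms(2)
    by (auto simp: is_component_def pre_digraph.sccs_def induced_subgraph_def subgraph_def)
  show C: "pair_graph C"
  proof unfold_locales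
    show "finite (pverts C)" using sub finite_verts finite_subset by blast
    show "finite (parcs C)" using arcs finite_arcs by simp
    show "symmetric (with_proj C)"
      using arcs sym_arcs by (auto simp: symmetric_def sym_def)
    show "fst e \<noteq> snd e" if "e \<in> parcs C" for e using that arcs no_loops by simp
  qed (use arcs in auto)
  then interpret C: pair_graph C .
  show "connected (with_proj C)"
    using sc C.reachable_mk_symmetricI unfolding connected_def strongly_connected_def by simp
qed


section \<open>The two graphs\<close>

definition path5 :: "nat pair_pre_digraph" where
  "path5 = \<lparr> pverts = {..<5}, parcs = {(x, y). x < 5 \<and> y < 5 \<and> (y = Suc x \<or> x = Suc y)} \<rparr>"

text \<open>
  Row \<open>a < 2\<close> is the vertex \<open>2 * a + 1\<close> of the path, column \<open>b < 3\<close> is the vertex \<open>2 * b\<close>, and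
  \<open>(a, b)\<close> is the vertex \<open>a + 2 * b\<close> of the other graph.
\<close>

abbreviation incident :: "nat \<Rightarrow> nat \<Rightarrow> bool" where
  "incident a b \<equiv> (2 * a + 1, 2 * b) \<in> parcs path5"

definition twisted :: "nat pair_pre_digraph" where
  "twisted = \<lparr> pverts = {..<6}, parcs = {(u, v). u < 6 \<and> v < 6 \<and>
     incident (u mod 2) (v div 2) \<and> incident (v mod 2) (u div 2)} \<rparr>"

text \<open>Parity of \<open>x\<close> tells whether the path vertex is a row or a column; it is
  exchanged with the coordinate of \<open>v\<close> of the same kind.\<close>

definition swap :: "nat \<times> nat \<Rightarrow> nat \<times> nat" where
  "swap = (\<lambda>(v, x).
     if odd x then (x div 2 + 2 * (v div 2), 2 * (v mod 2) + 1)
     else (v mod 2 + 2 * (x div 2), 2 * (v div 2)))"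

section \<open>Neighbourhoods and basic properties of the two graphs\<close>

lemma less_5_cases: "n < 5 \<longleftrightarrow> n \<in> {0, 1, 2, 3, 4}" for n :: nat
  by auto

lemma less_6_cases: "n < 6 \<longleftrightarrow> n \<in> {0, 1, 2, 3, 4, 5}" for n :: nat
  by auto

lemma nbhd_path5:
  "nbhd path5 0 = {1}" "nbhd path5 (Suc 0) = {0, 2}" "nbhd path5 2 = {1, 3}"
  "nbhd path5 3 = {2, 4}" "nbhd path5 4 = {3}"
  by (auto simp: path5_def)

text \<open>Filtering an explicit list lets simplification compute the neighbourhoods.\<close>

lemma nbhd_twisted_filter:
  assumes "u < 6"
  shows "nbhd twisted u = set (filter (\<lambda>v. incident (u mod 2) (v div 2) \<and> incident (v mod 2) (u div 2))
    [0, 1, 2, 3, 4, 5])"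
proof -
  have "set [0, 1, 2, 3, 4, 5] = {v :: nat. v < 6}" by auto
  then show ?thesis using assms unfolding set_filter by (simp add: twisted_def)
qed

lemma nbhd_twisted:
  "nbhd twisted 0 = {0, 2}" "nbhd twisted (Suc 0) = {2, 4}" "nbhd twisted 2 = {0, 1, 2, 3}"
  "nbhd twisted 3 = {2, 3, 4, 5}" "nbhd twisted 4 = {1, 3}" "nbhd twisted 5 = {3, 5}"
  by (simp_all add: nbhd_twisted_filter path5_def)

lemma pair_pseudo_graph_path5: "pair_pseudo_graph path5"
proof unfold_locales
  have "parcs path5 \<subseteq> {..<5} \<times> {..<5}" by (auto simp: path5_def)
  then show "finite (parcs path5)" using finite_subset by blast
qed (auto simp: path5_def symmetric_def sym_def)

lemma pair_pseudo_graph_twisted: "pair_pseudo_graph twisted"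
proof unfold_locales
  have "parcs twisted \<subseteq> {..<6} \<times> {..<6}" by (auto simp: twisted_def)
  then show "finite (parcs twisted)" using finite_subset by blast
qed (auto simp: twisted_def symmetric_def sym_def)

lemma pverts_path5: "pverts path5 = {0, 1, 2, 3, 4}"
  by (auto simp: path5_def)

lemma pverts_twisted: "pverts twisted = {0, 1, 2, 3, 4, 5}"
  by (auto simp: twisted_def)

lemma twin_free_path5: "twin_free path5"
  unfolding twin_free_def pverts_path5 by (simp add: nbhd_path5 doubleton_eq_iff)

lemma twin_free_twisted: "twin_free twisted"
proof -
  \<comment> \<open>The traces of the six neighbourhoods on these four vertices are already
    distinct.\<close>
  have "\<forall>u\<in>pverts twisted. \<forall>v\<in>pverts twisted. u \<noteq> v \<longrightarrow>
      (\<exists>w\<in>{0, 1, 3, 4}. w \<in> nbhd twisted u \<longleftrightarrow> w \<notin> nbhd twisted v)"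
    unfolding pverts_twisted by (simp add: nbhd_twisted del: Image_singleton_iff)
  then show ?thesis unfolding twin_free_def by auto
qed

lemma connected_path5: "connected (with_proj path5)"
proof (rule connected_if_reachable_from[OF pair_pseudo_graph_path5, of 0])
  fix v assume "v \<in> pverts path5"
  then have "v < 5" by (simp add: path5_def)
  then show "(0, v) \<in> (parcs path5)\<^sup>*"
  proof (induction v)
    case (Suc v)
    then have "(v, Suc v) \<in> parcs path5" by (simp add: path5_def)
    with Suc show ?case by (meson Suc_lessD rtrancl.rtrancl_into_rtrancl)
  qed simp
qed (simp add: path5_def)

lemma connected_twisted: "connected (with_proj twisted)"
proof (rule connected_if_reachable_from[OF pair_pseudo_graph_twisted, of 2])
  fix v assume "v \<in> pverts twisted"
  then have "v \<in> {0, 1, 2, 3} \<or> v \<in> {2, 3, 4, 5}" by (auto simp: twisted_def)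
  \<comment> \<open>Vertices 2 and 3 are adjacent, and their neighbourhoods cover the graph.\<close>
  then have "(2, v) \<in> parcs twisted \<or> (2, 3) \<in> parcs twisted \<and> (3, v) \<in> parcs twisted"
    using nbhd_twisted(3,4) by blast
  then show "(2, v) \<in> (parcs twisted)\<^sup>*"
    by (meson r_into_rtrancl rtrancl_trans)
qed (simp add: twisted_def)

lemma bipartite_path5: "bipartite path5"
  unfolding bipartite_def
proof (intro exI conjI)
  have "0 \<in> {x \<in> pverts path5. even x}" "1 \<in> {x \<in> pverts path5. odd x}"
    by (simp_all add: path5_def)
  then show "{x \<in> pverts path5. even x} \<noteq> {}" "{x \<in> pverts path5. odd x} \<noteq> {}" by blast+
qed (auto simp: path5_def)

lemma not_bipartite_twisted: "\<not> bipartite twisted"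
proof -
  \<comment> \<open>A loop rules out any bipartition.\<close>
  have "(0, 0) \<in> parcs twisted" by (simp add: twisted_def path5_def)
  then show ?thesis unfolding bipartite_def by blast
qed

section \<open>The exchange automorphism, mixing and instability\<close>

lemma swap_swap: "p \<in> {..<6} \<times> {..<5} \<Longrightarrow> swap (swap p) = p"
  by (auto simp: swap_def less_6_cases less_5_cases)

lemma swap_mem: "p \<in> {..<6} \<times> {..<5} \<Longrightarrow> swap p \<in> {..<6} \<times> {..<5}"
  by (auto simp: swap_def less_6_cases less_5_cases)

lemma path5_arc_cases:
  assumes "(x, y) \<in> parcs path5"
  obtains a b where "x = 2 * a + 1" "y = 2 * b" "incident a b"
    | a b where "x = 2 * b" "y = 2 * a + 1" "incident a b"
proof (cases "odd x")
  case True
  then have "x = 2 * (x div 2) + 1" "y = 2 * (y div 2)"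
    using assms by (auto simp: path5_def)
  with assms that(1) show ?thesis by metis
next
  case False
  then have "x = 2 * (x div 2)" "y = 2 * (y div 2) + 1" "(y, x) \<in> parcs path5"
    using assms by (auto simp: path5_def)
  with that(2) show ?thesis by metis
qed

lemma twisted_arc_iff:
  assumes "a < 2" "a' < 2"
  shows "(a + 2 * b, a' + 2 * b') \<in> parcs twisted \<longleftrightarrow> incident a b' \<and> incident a' b"
  using assms by (auto simp: twisted_def path5_def)

text \<open>An arc of the product amounts to three incidences. For either orientation of the path
  arc, \<open>swap\<close> only permutes which of them belongs to the path and which two belong to
  \<open>twisted\<close>.\<close>

lemma swap_arc:
  assumes "(p, q) \<in> parcs (twisted \<otimes>\<^sub>g path5)"
  shows "(swap p, swap q) \<in> parcs (twisted \<otimes>\<^sub>g path5)"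
proof -
  obtain u x v y where pq: "p = (u, x)" "q = (v, y)" by fastforce
  have uv: "incident (u mod 2) (v div 2)" "incident (v mod 2) (u div 2)"
    and xy: "(x, y) \<in> parcs path5"
    using assms by (auto simp: pq direct_product_def twisted_def)
  have sym: "(y, x) \<in> parcs path5 \<longleftrightarrow> (x, y) \<in> parcs path5" for x y
    by (auto simp: path5_def)
  have row: "a < 2" if "incident a b" for a b
    using that by (auto simp: path5_def)
  from xy show ?thesis
  proof (cases rule: path5_arc_cases)
    case (1 a b)
    with uv row show ?thesis
      by (simp add: pq swap_def direct_product_def twisted_arc_iff)
  next
    case (2 a b)
    with uv row sym show ?thesis
      by (simp add: pq swap_def direct_product_def twisted_arc_iff)
  qed
qed

lemma swap_automorphism:
  "restrict swap ({..<6} \<times> {..<5}) \<in> automorphisms (twisted \<otimes>\<^sub>g path5)"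
proof -
  have verts: "pverts (twisted \<otimes>\<^sub>g path5) = {..<6} \<times> {..<5}"
    by (simp add: direct_product_def twisted_def path5_def)
  have "bij_betw swap ({..<6} \<times> {..<5}) ({..<6} \<times> {..<5})"
    by (rule bij_betwI[where g = swap]) (use swap_mem swap_swap in auto)
  then have "bij_betw (restrict swap ({..<6} \<times> {..<5})) ({..<6} \<times> {..<5}) ({..<6} \<times> {..<5})"
    by (simp cong: bij_betw_cong)
  moreover have "(swap p, swap q) \<in> parcs (twisted \<otimes>\<^sub>g path5) \<longleftrightarrow> (p, q) \<in> parcs (twisted \<otimes>\<^sub>g path5)"
    if "p \<in> {..<6} \<times> {..<5}" "q \<in> {..<6} \<times> {..<5}" for p q
    \<comment> \<open>The converse follows because \<open>swap\<close> is an involution.\<close>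
    using swap_arc[of p q] swap_arc[of "swap p" "swap q"] swap_swap that by auto
  ultimately show ?thesis unfolding automorphisms_def verts by simp
qed

lemma swap_mixer: "mixer twisted path5 (restrict swap ({..<6} \<times> {..<5}))"
  (is "mixer _ _ ?\<phi>")
  unfolding mixer_def
proof (intro conjI notI)
  assume *: "(\<lambda>P. ?\<phi> ` P) ` snd_partition twisted path5 = snd_partition twisted path5"
  have "{..<6} \<times> {1} \<in> snd_partition twisted path5"
    by (auto simp: snd_partition_def twisted_def path5_def)
  with * have "?\<phi> ` ({..<6} \<times> {1}) \<in> snd_partition twisted path5" by blast
  then obtain x where x: "?\<phi> ` ({..<6} \<times> {1}) = {..<6} \<times> {x}"
    by (auto simp: snd_partition_def twisted_def)
  have "?\<phi> (v, 1) \<in> {..<6} \<times> {x}" if "v < 6" for v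
    using that unfolding x[symmetric] by (intro imageI) simp
  \<comment> \<open>Both points lie over path vertex 1, but their images lie over 1 and 3.\<close>
  from this[of 0] this[of 1] have "snd (swap (0, 1)) = snd (swap (1, 1))"
    by (simp add: mem_Times_iff)
  then show False by (simp add: swap_def)
qed (fact swap_automorphism)

lemma not_stable_twisted_path5: "\<not> stable twisted path5"
proof
  assume "stable twisted path5"
  then obtain f g where fg:
    "restrict swap ({..<6} \<times> {..<5}) = restrict (map_prod f g) (pverts twisted \<times> pverts path5)"
    using swap_automorphism unfolding stable_def by blast
  \<comment> \<open>Under a componentwise map the second coordinate of the image cannot depend on
    \<open>v\<close>.\<close>
  have "snd (swap (v, 1)) = g 1" if "v < 6" for v
    using fun_cong[OF fg, of "(v, 1)"] that by (simp add: twisted_def path5_def)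
  from this[of 0] this[of 1] show False by (simp add: swap_def)
qed

section \<open>The Cartesian skeletons of the two graphs\<close>

lemma cartesian_skeleton_arcI:
  "u \<in> pverts G \<Longrightarrow> v \<in> pverts G \<Longrightarrow> u \<noteq> v \<Longrightarrow> nbhd G u \<inter> nbhd G v \<noteq> {} \<Longrightarrow>
    \<not> dispensable G u v \<Longrightarrow> (u, v) \<in> parcs (cartesian_skeleton G)"
  by (simp add: cartesian_skeleton_def boolean_square_def)

text \<open>These five edges form the spanning path 4-2-0-1-3-5, enough for connectedness.\<close>

lemma skeleton_twisted_arcs:
  assumes "(u, v) \<in> {(0, 1), (0, 2), (1, 3), (2, 4), (3, 5)}"
  shows "(u, v) \<in> parcs (cartesian_skeleton twisted)"
proof (rule cartesian_skeleton_arcI)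
  show "\<not> dispensable twisted u v"
    using assms unfolding dispensable_def pverts_twisted
    by (elim insertE) (simp_all add: nbhd_twisted subset_not_subset_eq del: Image_singleton_iff)
qed (use assms in \<open>auto simp: pverts_twisted nbhd_twisted\<close>)

lemma connected_skeleton_twisted: "connected (with_proj (cartesian_skeleton twisted))"
proof -
  let ?S = "cartesian_skeleton twisted"
  have verts: "pverts ?S = {..<6}" by (simp add: cartesian_skeleton_def twisted_def)
  have "pair_graph ?S"
    by (rule pair_graph_cartesian_skeleton) (simp add: twisted_def)
  then interpret pair_graph ?S .
  have step: "(0, v) \<in> (parcs ?S)\<^sup>*"
    if "(0, u) \<in> (parcs ?S)\<^sup>*" "(u, v) \<in> {(0, 1), (0, 2), (1, 3), (2, 4), (3, 5)}" for u v
    using that(1) skeleton_twisted_arcs[OF that(2)] by (rule rtrancl_into_rtrancl)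
  have 0: "(0, 0) \<in> (parcs ?S)\<^sup>*" by simp
  have 1: "(0, 1) \<in> (parcs ?S)\<^sup>*" by (rule step[OF 0]) simp
  have 2: "(0, 2) \<in> (parcs ?S)\<^sup>*" by (rule step[OF 0]) simp
  have 3: "(0, 3) \<in> (parcs ?S)\<^sup>*" by (rule step[OF 1]) simp
  have 4: "(0, 4) \<in> (parcs ?S)\<^sup>*" by (rule step[OF 2]) simp
  have 5: "(0, 5) \<in> (parcs ?S)\<^sup>*" by (rule step[OF 3]) simp
  have "(0, v) \<in> (parcs ?S)\<^sup>*" if "v \<in> pverts ?S" for v
    using that 0 1 2 3 4 5 unfolding verts lessThan_iff less_6_cases by blast
  then show ?thesis
    by (intro connected_if_reachable_from[of _ 0] pair_pseudo_graph) (simp_all add: verts)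
qed

text \<open>Adjacent vertices of the skeleton share a neighbour in the path, and path arcs change
  parity.\<close>

lemma skeleton_path5_parity:
  assumes "(u, v) \<in> parcs (cartesian_skeleton path5)"
  shows "even u \<longleftrightarrow> even v"
  using assms by (auto simp: cartesian_skeleton_def boolean_square_def path5_def)

text \<open>A component stays within one parity class, \<open>{0, 2, 4}\<close> or
  \<open>{1, 3}\<close>; this bound suffices for squarefreeness.\<close>

lemma card_component_skeleton_path5:
  assumes "is_component C (cartesian_skeleton path5)"
  shows "card (pverts C) \<in> {1, 2, 3}"
proof -
  have "induced_subgraph (with_proj C) (with_proj (cartesian_skeleton path5))"
    and sc: "strongly_connected (with_proj C)"
    using assms by (auto simp: is_component_def pre_digraph.sccs_def)
  then have sub: "pverts C \<subseteq> {..<5}" and arcs: "parcs C \<subseteq> parcs (cartesian_skeleton path5)"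
    by (auto simp: induced_subgraph_def subgraph_def cartesian_skeleton_def path5_def)
  obtain r where r: "r \<in> pverts C"
    using sc by (auto simp: strongly_connected_def)
  have parity: "even v \<longleftrightarrow> even r" if "v \<in> pverts C" for v
  proof -
    have "r \<rightarrow>\<^sup>*\<^bsub>with_proj C\<^esub> v"
      using sc r that by (auto simp: strongly_connected_def)
    then show ?thesis
      unfolding reachable_def
      by (induction rule: rtrancl_on_induct) (use arcs skeleton_path5_parity in auto)
  qed
  have "card (pverts C) \<le> 3"
  proof (cases "even r")
    case True
    then have "pverts C \<subseteq> {0, 2, 4}"
      using sub parity by (fastforce simp: less_5_cases)
    from card_mono[OF _ this] show ?thesis by simp
  next
    case False
    then have "pverts C \<subseteq> {1, 3}"
      using sub parity by (fastforce simp: less_5_cases)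
    from card_mono[OF _ this] show ?thesis by simp
  qed
  moreover have "card (pverts C) \<noteq> 0"
    using r finite_subset[OF sub] by auto
  ultimately show ?thesis by auto
qed

lemma squarefree_6: "squarefree (6 :: nat)"
  using squarefree_mult_coprime[of "2 :: nat" 3] by (simp add: squarefree_prime coprime_Suc_right_nat)

theorem mainTheorem5:
  shows "\<exists>(\<Gamma> :: nat pair_pre_digraph) (\<Sigma> :: nat pair_pre_digraph).
    pair_pseudo_graph \<Gamma> \<and> pair_pseudo_graph \<Sigma> \<and>
    nontrivially_unstable \<Gamma> \<Sigma> \<and> \<not> bipartite \<Gamma> \<and> bipartite \<Sigma> \<and>
    (\<exists>\<phi>. mixer \<Gamma> \<Sigma> \<phi>) \<and>
    (\<forall>C. is_component C (cartesian_skeleton \<Sigma>) \<longrightarrow>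
         cart_quasicoprime C (cartesian_skeleton \<Gamma>))"
proof (intro exI conjI allI impI)
  have card: "card (pverts twisted) = 6" "card (pverts path5) = 5"
    by (simp_all add: twisted_def path5_def)
  have "coprime (6 :: nat) 5"
    using coprime_Suc_left_nat[of 5] by simp
  then have "coprime_graphs twisted path5"
    by (intro coprime_graphs_if_coprime_card) (simp add: card)
  then show "nontrivially_unstable twisted path5"
    unfolding nontrivially_unstable_def nontrivial_pair_def
    using connected_twisted connected_path5 twin_free_twisted twin_free_path5 bipartite_path5
      not_bipartite_twisted not_stable_twisted_path5 by simp
  show "cart_quasicoprime C (cartesian_skeleton twisted)"
    if C: "is_component C (cartesian_skeleton path5)" for C
  proof (rule cart_quasicoprime_if_squarefree_card)
    have "pair_graph (cartesian_skeleton path5)"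
      by (rule pair_graph_cartesian_skeleton) (simp add: path5_def)
    then show "pair_graph C" "connected (with_proj C)"
      using component_pair_graph_connected C by blast+
    show "squarefree (card (pverts C))"
      \<comment> \<open>Each of 1, 2 and 3 divides 6, and divisors of squarefree numbers are
        squarefree.\<close>
      using card_component_skeleton_path5[OF C] by (intro squarefree_mono[OF _ squarefree_6]) auto
    show "pair_graph (cartesian_skeleton twisted)"
      by (rule pair_graph_cartesian_skeleton) (simp add: twisted_def)
    show "squarefree (card (pverts (cartesian_skeleton twisted)))"
      using squarefree_6 card by (simp add: cartesian_skeleton_def)
  qed (fact connected_skeleton_twisted)
qed (fact pair_pseudo_graph_twisted pair_pseudo_graph_path5 not_bipartite_twisted bipartite_path5
    swap_mixer)+

end
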